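(* Let $X$ be a Hausdorff Abelian topological group. Then: (i) $X$ is an $(E)$-space if and only if $\mathfrak{F}_0(X)$ is an $(E)$-space. (ii) $X$ is a strictly angelic space if and only if $\mathfrak{F}_0(X)$ is a strictly angelic space. (iii) $X$ is a Š-space if and only if $\mathfrak{F}_0(X)$ is a Š-space.
   Context: For an Abelian topological group $X$, $\mathfrak{F}_0(X)$ denotes the group $c_0(X)=\{(x_n)_{n\in\mathbb{N}}\in X^{\mathbb{N}}:\lim_n x_n=0\}$ with coordinatewise operations and the uniform topology, i.e. the group topology with base at $0$ given by the sets $V^{\mathbb{N}}\cap c_0(X)$, where $V$ runs over the open neighborhoods of $0$ in $X$. A subset $A$ of a topological space $Y$ is: relatively compact if its closure $\overline{A}$ is compact; relatively countably compact if each countably infinite subset of $A$ has a cluster point in $Y$; sequentially compact if each sequence in $A$ has a subsequence converging to a point of $A$. A Hausdorff topological space $Y$ is called: - an $(E)$-space if its relatively countably compact subsets are relatively compact; - a Š-space if its compact subsets are sequentially compact; - an angelic space if for every relatively countably compact subset $A$ of $Y$: (a) $A$ is relatively compact, and (b) if $x\in\overline{A}$, then there is a sequence in $A$ which converges to $x$; - a strictly angelic space if it is angelic and each of its separable compact subspaces is first countable. *)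

theory Defs
  imports "HOL-Analysis.Analysis"
begin

definition relatively_compactin :: "'a topology \<Rightarrow> 'a set \<Rightarrow> bool" where
  "relatively_compactin Y A \<longleftrightarrow> A \<subseteq> topspace Y \<and> compactin Y (Y closure_of A)"

text \<open>A cluster point of a set is an accumulation point of it, that is, an element of its
  derived set. (For Hausdorff spaces, the only ones considered below, each neighbourhood of
  such a point contains infinitely many points of the set.) It need not belong to the set.\<close>

definition relatively_countably_compactin :: "'a topology \<Rightarrow> 'a set \<Rightarrow> bool" where
  "relatively_countably_compactin Y A \<longleftrightarrow>
     A \<subseteq> topspace Y \<and>
     (\<forall>B. B \<subseteq> A \<and> countable B \<and> infinite B \<longrightarrow> Y derived_set_of B \<noteq> {})"

definition sequentially_compactin :: "'a topology \<Rightarrow> 'a set \<Rightarrow> bool" where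
  "sequentially_compactin Y A \<longleftrightarrow>
     A \<subseteq> topspace Y \<and>
     (\<forall>\<sigma>::nat \<Rightarrow> 'a. range \<sigma> \<subseteq> A \<longrightarrow>
        (\<exists>l\<in>A. \<exists>r::nat \<Rightarrow> nat. strict_mono r \<and> limitin Y (\<sigma> \<circ> r) l sequentially))"

definition E_space :: "'a topology \<Rightarrow> bool" where
  "E_space Y \<longleftrightarrow>
     Hausdorff_space Y \<and>
     (\<forall>A. relatively_countably_compactin Y A \<longrightarrow> relatively_compactin Y A)"

text \<open>These are the spaces denoted by an S with caron (after Smulian).\<close>

definition Smulian_space :: "'a topology \<Rightarrow> bool" where
  "Smulian_space Y \<longleftrightarrow>
     Hausdorff_space Y \<and> (\<forall>K. compactin Y K \<longrightarrow> sequentially_compactin Y K)"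

definition angelic_space :: "'a topology \<Rightarrow> bool" where
  "angelic_space Y \<longleftrightarrow>
     Hausdorff_space Y \<and>
     (\<forall>A. relatively_countably_compactin Y A \<longrightarrow>
        relatively_compactin Y A \<and>
        (\<forall>x \<in> Y closure_of A.
           \<exists>\<sigma>::nat \<Rightarrow> 'a. range \<sigma> \<subseteq> A \<and> limitin Y \<sigma> x sequentially))"

definition strictly_angelic_space :: "'a topology \<Rightarrow> bool" where
  "strictly_angelic_space Y \<longleftrightarrow>
     angelic_space Y \<and>
     (\<forall>K. compactin Y K \<and> separable_space (subtopology Y K) \<longrightarrow>
        first_countable (subtopology Y K))"

definition c0 :: "(nat \<Rightarrow> 'a::topological_ab_group_add) set" where
  "c0 = {x. x \<longlonglongrightarrow> 0}"

definition c0_nhd :: "'a set \<Rightarrow> (nat \<Rightarrow> 'a::topological_ab_group_add) set" where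
  "c0_nhd V = {v \<in> c0. \<forall>n. v n \<in> V}"

text \<open>The group topology on \<open>c0\<close> with the sets \<open>c0_nhd V\<close>, for \<open>V\<close> an open neighbourhood of
  \<open>0\<close>, as a base at \<open>0\<close>: a subset of \<open>c0\<close> is open iff with each point it contains a translate
  of some \<open>c0_nhd V\<close> to that point. Its underlying set is \<open>c0\<close>, not the whole function
  type.\<close>

definition F0 :: "(nat \<Rightarrow> 'a::topological_ab_group_add) topology" where
  "F0 = topology (\<lambda>U. U \<subseteq> c0 \<and>
     (\<forall>x\<in>U. \<exists>V. open V \<and> 0 \<in> V \<and> (\<lambda>v n. x n + v n) ` c0_nhd V \<subseteq> U))"

lemma openin_F0:
  "openin F0 U \<longleftrightarrow> U \<subseteq> c0 \<and>
     (\<forall>x\<in>U. \<exists>V. open V \<and> 0 \<in> V \<and> (\<lambda>v n. x n + v n) ` c0_nhd V \<subseteq> U)"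
proof -
  let ?P = "\<lambda>U :: (nat \<Rightarrow> 'a) set. U \<subseteq> c0 \<and>
     (\<forall>x\<in>U. \<exists>V. open V \<and> 0 \<in> V \<and> (\<lambda>v n. x n + v n) ` c0_nhd V \<subseteq> U)"
  have "istopology ?P"
    unfolding istopology_def
  proof (intro conjI allI impI)
    fix S T :: "(nat \<Rightarrow> 'a) set"
    assume S: "?P S" and T: "?P T"
    show "S \<inter> T \<subseteq> c0" using S by blast
    show "\<forall>x\<in>S \<inter> T. \<exists>V. open V \<and> 0 \<in> V \<and> (\<lambda>v n. x n + v n) ` c0_nhd V \<subseteq> S \<inter> T"
    proof
      fix x assume "x \<in> S \<inter> T"
      then obtain V W where "open V" "0 \<in> V" "(\<lambda>v n. x n + v n) ` c0_nhd V \<subseteq> S"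
        and "open W" "0 \<in> W" "(\<lambda>v n. x n + v n) ` c0_nhd W \<subseteq> T"
        using S T by blast
      moreover have "c0_nhd (V \<inter> W) \<subseteq> c0_nhd V" "c0_nhd (V \<inter> W) \<subseteq> c0_nhd W"
        by (auto simp: c0_nhd_def)
      ultimately show "\<exists>V. open V \<and> 0 \<in> V \<and> (\<lambda>v n. x n + v n) ` c0_nhd V \<subseteq> S \<inter> T"
        by (intro exI[of _ "V \<inter> W"]) (simp add: open_Int, blast)
    qed
  next
    fix K :: "(nat \<Rightarrow> 'a) set set"
    assume K: "\<forall>U\<in>K. ?P U"
    show "\<Union>K \<subseteq> c0" using K by blast
    show "\<forall>x\<in>\<Union>K. \<exists>V. open V \<and> 0 \<in> V \<and> (\<lambda>v n. x n + v n) ` c0_nhd V \<subseteq> \<Union>K"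
    proof
      fix x assume "x \<in> \<Union>K"
      then obtain U where U: "U \<in> K" "x \<in> U" by (rule UnionE)
      then obtain V where "open V" "0 \<in> V" "(\<lambda>v n. x n + v n) ` c0_nhd V \<subseteq> U"
        using K[rule_format, OF U(1)] by blast
      moreover have "U \<subseteq> \<Union>K" using U(1) by (rule Union_upper)
      ultimately show "\<exists>V. open V \<and> 0 \<in> V \<and> (\<lambda>v n. x n + v n) ` c0_nhd V \<subseteq> \<Union>K"
        by (meson subset_trans)
    qed
  qed
  then show ?thesis by (simp add: F0_def topology_inverse')
qed

lemma topspace_F0 [simp]: "topspace F0 = c0"
proof -
  have "(\<lambda>v n. x n + v n) ` c0_nhd UNIV \<subseteq> c0" if "x \<in> c0" for x :: "nat \<Rightarrow> 'a"
    using that by (auto simp: c0_nhd_def c0_def intro!: tendsto_add_zero)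
  then have "openin F0 (c0 :: (nat \<Rightarrow> 'a) set)"
    unfolding openin_F0 by (intro conjI ballI exI[of _ UNIV]) auto
  moreover have "topspace F0 \<subseteq> (c0 :: (nat \<Rightarrow> 'a) set)"
    using openin_topspace[of F0] unfolding openin_F0 by (rule conjunct1)
  ultimately show ?thesis by (simp add: openin_subset subset_antisym)
qed

lemma openin_F0_c0_nhd:
  assumes V: "open V" "0 \<in> V"
  shows "openin F0 (c0_nhd V)"
  unfolding openin_F0
proof (intro conjI ballI)
  show "c0_nhd V \<subseteq> c0" by (auto simp: c0_nhd_def)
  fix x :: "nat \<Rightarrow> 'a" assume x: "x \<in> c0_nhd V"
  have x0: "x \<longlonglongrightarrow> 0" and xV: "\<And>n. x n \<in> V"
    using x by (auto simp: c0_nhd_def c0_def)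
  show "\<exists>W. open W \<and> 0 \<in> W \<and> (\<lambda>v n. x n + v n) ` c0_nhd W \<subseteq> c0_nhd V"
  proof -
    have "\<exists>A B. open A \<and> open B \<and> 0 \<in> A \<and> 0 \<in> B \<and> (\<forall>a\<in>A. \<forall>b\<in>B. a + b \<in> V)"
    proof -
      have "\<forall>\<^sub>F p in nhds (0::'a) \<times>\<^sub>F nhds 0. fst p + snd p \<in> V"
        using tendsto_add_Pair[of "0::'a" 0] V
        by (simp add: tendsto_def)
      then obtain P Q where "eventually P (nhds (0::'a))" "eventually Q (nhds (0::'a))"
        and PQ: "\<And>a b. P a \<Longrightarrow> Q b \<Longrightarrow> a + b \<in> V"
        unfolding eventually_prod_filter by auto
      then obtain A B where "open A" "0 \<in> A" "\<forall>a\<in>A. P a" "open B" "0 \<in> B" "\<forall>b\<in>B. Q b"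
        unfolding eventually_nhds by blast
      then show ?thesis using PQ by (intro exI[of _ A] exI[of _ B]) simp
    qed
    then obtain A B where AB: "open A" "open B" "0 \<in> A" "0 \<in> B"
      and add: "\<And>a b. a \<in> A \<Longrightarrow> b \<in> B \<Longrightarrow> a + b \<in> V" by blast
    obtain N where N: "\<And>n. n \<ge> N \<Longrightarrow> x n \<in> A"
      using AB topological_tendstoD[OF x0] unfolding eventually_sequentially by blast
    define C where "C n = (\<lambda>b. x n + b) -` V" for n
    have C: "open (C n)" "0 \<in> C n" for n
      using xV V by (auto simp: C_def intro!: open_vimage continuous_intros)
    let ?W = "B \<inter> (\<Inter>n<N. C n)"
    have "open ?W" "0 \<in> ?W" using AB C by auto
    moreover have "(\<lambda>v n. x n + v n) ` c0_nhd ?W \<subseteq> c0_nhd V"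
    proof clarify
      fix v assume v: "v \<in> c0_nhd ?W"
      have "x n + v n \<in> V" for n
      proof (cases "n < N")
        case True
        then show ?thesis using v by (auto simp: c0_nhd_def C_def)
      next
        case False
        then show ?thesis using v N add by (auto simp: c0_nhd_def)
      qed
      moreover have "(\<lambda>n. x n + v n) \<longlonglongrightarrow> 0"
        using v x0 by (auto simp: c0_nhd_def c0_def intro!: tendsto_add_zero)
      ultimately show "(\<lambda>n. x n + v n) \<in> c0_nhd V" by (simp add: c0_nhd_def c0_def)
    qed
    ultimately show ?thesis by blast
  qed
qed

end

theory Submission
  imports Defs "HOL-Library.Diagonal_Subsequence"
begin

text \<open>Each of the three properties passes from \<open>F0\<close> to the group, which is a retract of \<open>F0\<close> via
  the zeroth coordinate. Conversely, a relatively countably compact set \<open>A\<close> of null sequences is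
  uniformly null: every neighbourhood of zero contains all \<open>x n\<close> with \<open>x \<in> A\<close> and \<open>n\<close> large. On a
  uniformly null set the topology of \<open>F0\<close> is the topology of pointwise convergence, so that
  compactness comes from Tychonoff's theorem, sequential compactness from a diagonal subsequence,
  and first countability of separable compact sets from that of their coordinate projections.
  For strict angelicity it remains to reach a point of a compact closure from a countable subset;
  then its closure is separable, hence first countable.\<close>

subsection \<open>Relative compactness, first countability and retractions\<close>

text \<open>A countably infinite subset of the image is the bijective image of some infinite
  \<open>C\<close> in \<open>A\<close>, which has a cluster point \<open>z\<close>. As
  \<open>X\<close> is Hausdorff, every neighbourhood of \<open>z\<close> meets \<open>C\<close>
  infinitely often. By injectivity infinitely many image points are close to \<open>f z\<close>, so
  one differs from \<open>f z\<close>.\<close>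

lemma relatively_countably_compactin_continuous_map_image:
  assumes A: "relatively_countably_compactin X A" and f: "continuous_map X Y f"
    and X: "Hausdorff_space X"
  shows "relatively_countably_compactin Y (f ` A)"
  unfolding relatively_countably_compactin_def
proof (intro conjI allI impI; (elim conjE)?)
  show "f ` A \<subseteq> topspace Y"
    using A continuous_map_image_subset_topspace[OF f]
    unfolding relatively_countably_compactin_def by blast
next
  fix B assume B: "B \<subseteq> f ` A" "countable B" "infinite B"
  then obtain C where C: "C \<subseteq> A" "inj_on f C" "B = f ` C"
    by (meson subset_image_inj)
  have "countable C" "infinite C"
    using B C by (auto simp: countable_image_inj_eq finite_image_iff)
  then obtain z where z: "z \<in> X derived_set_of C"
    using A C unfolding relatively_countably_compactin_def by blast
  have "f z \<in> Y derived_set_of B"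
    unfolding in_derived_set_of
  proof (intro conjI allI impI)
    show "f z \<in> topspace Y"
      using z f by (auto simp: in_derived_set_of continuous_map_def)
    fix U assume U: "f z \<in> U \<and> openin Y U"
    let ?V = "{x \<in> topspace X. f x \<in> U}"
    have "openin X ?V" "z \<in> ?V"
      using U z f by (auto simp: in_derived_set_of intro: openin_continuous_map_preimage)
    moreover have "\<forall>U. z \<in> U \<and> openin X U \<longrightarrow> infinite (C \<inter> U)"
      using z by (simp add: derived_set_of_infinite_openin[OF X])
    ultimately have "infinite (C \<inter> ?V)"
      by meson
    then have "infinite (f ` (C \<inter> ?V))"
      using C(2) by (metis finite_imageD inf_le1 inj_on_subset)
    then have "infinite (f ` (C \<inter> ?V) - {f z})"
      by simp
    then have "f ` (C \<inter> ?V) - {f z} \<noteq> {}"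
      by (metis finite.emptyI)
    then show "\<exists>y. y \<noteq> f z \<and> y \<in> B \<and> y \<in> U"
      using C by blast
  qed
  then show "Y derived_set_of B \<noteq> {}" by blast
qed

lemma relatively_compactin_imp_relatively_countably_compactin:
  assumes "relatively_compactin Y A"
  shows "relatively_countably_compactin Y A"
proof -
  have A: "A \<subseteq> topspace Y" "compactin Y (Y closure_of A)"
    using assms by (simp_all add: relatively_compactin_def)
  have "Y derived_set_of B \<noteq> {}" if "B \<subseteq> A" "infinite B" for B
    using A(2) that(2,1) subset_trans[OF that(1) A(1)]
    by (rule compact_closure_of_imp_Bolzano_Weierstrass)
  then show ?thesis
    using A(1) by (simp add: relatively_countably_compactin_def)
qed

lemma relatively_compactin_subset_compactin:
  assumes "Hausdorff_space Y" "compactin Y K" "A \<subseteq> K"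
  shows "relatively_compactin Y A"
proof -
  have "Y closure_of A \<subseteq> K"
    using assms by (simp add: closure_of_minimal compactin_imp_closedin)
  then show ?thesis
    unfolding relatively_compactin_def
    using assms closed_compactin[OF assms(2) _ closedin_closure_of]
      compactin_subset_topspace[OF assms(2)] by simp
qed

section \<open>First countability: sequences and countable products\<close>

lemma first_countable_closure_of_sequentially:
  assumes Y: "first_countable Y" and x: "x \<in> Y closure_of A"
  shows "\<exists>\<sigma>::nat \<Rightarrow> 'a. range \<sigma> \<subseteq> A \<and> limitin Y \<sigma> x sequentially"
proof -
  have xY: "x \<in> topspace Y"
    using x by (auto simp: in_closure_of)
  then obtain \<B> where \<B>: "countable \<B>" "\<And>V. V \<in> \<B> \<Longrightarrow> openin Y V"
    and base: "\<And>U. openin Y U \<Longrightarrow> x \<in> U \<Longrightarrow> \<exists>V\<in>\<B>. x \<in> V \<and> V \<subseteq> U"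
    using Y unfolding first_countable_def by metis
  define \<C> where "\<C> = {V \<in> \<B>. x \<in> V}"
  have "\<C> \<noteq> {}" "countable \<C>"
    using base[OF openin_topspace xY] \<B>(1) by (auto simp: \<C>_def)
  then have ran: "range (from_nat_into \<C>) = \<C>"
    by (rule range_from_nat_into)
  \<comment> \<open>Finite intersections make the neighbourhoods decrease: points chosen from
    \<open>W n\<close> lie in the \<open>N\<close>-th basic set for all \<open>n \<ge> N\<close>,
    not only for \<open>n = N\<close>.\<close>
  define W where "W n = (\<Inter>i\<le>n. from_nat_into \<C> i)" for n :: nat
  have W: "openin Y (W n)" "x \<in> W n" for n
  proof -
    have "from_nat_into \<C> i \<in> \<C>" for i
      using ran by blast
    then show "openin Y (W n)" "x \<in> W n"
      using \<B>(2) unfolding W_def \<C>_def by (auto intro!: openin_INT2)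
  qed
  then have "\<exists>y. y \<in> A \<and> y \<in> W n" for n
    using x unfolding in_closure_of by meson
  then obtain \<sigma> where \<sigma>: "\<And>n. \<sigma> n \<in> A" "\<And>n. \<sigma> n \<in> W n"
    by metis
  have "limitin Y \<sigma> x sequentially"
    unfolding limitin_sequentially
  proof (intro conjI allI impI)
    fix U assume "openin Y U \<and> x \<in> U"
    then obtain V where "V \<in> \<C>" "V \<subseteq> U"
      using base unfolding \<C>_def by blast
    then obtain N where "from_nat_into \<C> N \<subseteq> U"
      using ran by (metis imageE)
    then show "\<exists>N. \<forall>n\<ge>N. \<sigma> n \<in> U"
      using \<sigma>(2) unfolding W_def by blast
  qed (use xY in auto)
  with \<sigma>(1) show ?thesis by blast
qed

text \<open>A local base at \<open>x\<close> is formed by the cylinders over finitely many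
  coordinates whose sides come from countable local bases at the points \<open>x i\<close>. There
  are countably many, since a countable set has countably many finite subsets.\<close>

lemma first_countable_product_topology:
  assumes I: "countable I" and Y: "\<And>i. i \<in> I \<Longrightarrow> first_countable (Y i)"
  shows "first_countable (product_topology Y I)"
  unfolding first_countable_def
proof
  let ?P = "product_topology Y I"
  fix x assume x: "x \<in> topspace ?P"
  have "\<exists>\<B>. countable \<B> \<and> (\<forall>V\<in>\<B>. openin (Y i) V) \<and>
      (\<forall>U. openin (Y i) U \<and> x i \<in> U \<longrightarrow> (\<exists>V\<in>\<B>. x i \<in> V \<and> V \<subseteq> U))" if "i \<in> I" for i
    using Y[OF that] x that unfolding first_countable_def by (auto simp: PiE_iff)
  then obtain \<B> where \<B>: "\<And>i. i \<in> I \<Longrightarrow> countable (\<B> i)"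
      "\<And>i V. i \<in> I \<Longrightarrow> V \<in> \<B> i \<Longrightarrow> openin (Y i) V"
    and base: "\<And>i U. i \<in> I \<Longrightarrow> openin (Y i) U \<Longrightarrow> x i \<in> U \<Longrightarrow> \<exists>V\<in>\<B> i. x i \<in> V \<and> V \<subseteq> U"
    by metis
  \<comment> \<open>A finite set \<open>F\<close> of pairs (index, basic set) encodes a cylinder.
    Intersecting with the whole space gives the empty \<open>F\<close> the right meaning.\<close>
  define cyl where "cyl F = topspace ?P \<inter> (\<Inter>p\<in>F. {y \<in> topspace ?P. y (fst p) \<in> snd p})" for F
  let ?\<F> = "{F. finite F \<and> F \<subseteq> Sigma I \<B>}"
  have "countable ?\<F>"
    using I \<B>(1) by (intro countable_Collect_finite_subset countable_SIGMA)
  moreover have "openin ?P (cyl F)" if "F \<in> ?\<F>" for F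
  proof -
    have "openin ?P {y \<in> topspace ?P. y (fst p) \<in> snd p}" if "p \<in> F" for p
      using that \<open>F \<in> ?\<F>\<close> \<B>(2)
      by (intro openin_continuous_map_preimage[OF continuous_map_product_projection]) auto
    then have "openin ?P (\<Inter>p\<in>F. {y \<in> topspace ?P. y (fst p) \<in> snd p})" if "F \<noteq> {}"
      using that \<open>F \<in> ?\<F>\<close> by (intro openin_Inter) auto
    then show ?thesis
      unfolding cyl_def
      by (cases "F = {}") (simp_all only: image_empty Inf_empty Int_UNIV_right openin_topspace
          openin_Int not_False_eq_True simp_thms)
  qed
  moreover have "\<exists>F\<in>?\<F>. x \<in> cyl F \<and> cyl F \<subseteq> U" if U: "openin ?P U" "x \<in> U" for U
  proof -
    from U(1) have "\<forall>x\<in>U. \<exists>W. finite {i \<in> I. W i \<noteq> topspace (Y i)} \<and>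
        (\<forall>i\<in>I. openin (Y i) (W i)) \<and> x \<in> Pi\<^sub>E I W \<and> Pi\<^sub>E I W \<subseteq> U"
      by (simp only: openin_product_topology_alt)
    with U(2) obtain W where W: "finite {i \<in> I. W i \<noteq> topspace (Y i)}"
        "\<And>i. i \<in> I \<Longrightarrow> openin (Y i) (W i)" "x \<in> Pi\<^sub>E I W" "Pi\<^sub>E I W \<subseteq> U"
      by meson
    let ?J = "{i \<in> I. W i \<noteq> topspace (Y i)}"
    have "\<exists>V\<in>\<B> i. x i \<in> V \<and> V \<subseteq> W i" if "i \<in> ?J" for i
      using that W by (intro base) (auto simp: PiE_iff)
    then obtain B where B: "\<And>i. i \<in> ?J \<Longrightarrow> B i \<in> \<B> i \<and> x i \<in> B i \<and> B i \<subseteq> W i"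
      by metis
    let ?F = "(\<lambda>i. (i, B i)) ` ?J"
    have F: "?F \<in> ?\<F>" "x \<in> cyl ?F"
      using W(1) B x unfolding cyl_def by auto
    have "cyl ?F \<subseteq> Pi\<^sub>E I W"
    proof
      fix y assume y: "y \<in> cyl ?F"
      have "y i \<in> W i" if "i \<in> I" for i
        using y that B[of i] unfolding cyl_def by (cases "i \<in> ?J") (auto simp: PiE_iff)
      then show "y \<in> Pi\<^sub>E I W"
        using y unfolding cyl_def by (auto simp: PiE_iff)
    qed
    then have "cyl ?F \<subseteq> U"
      using W(4) by (rule subset_trans)
    then show ?thesis
      using F by (intro bexI[of _ ?F] conjI)
  qed
  ultimately have "countable (cyl ` ?\<F>)" "\<forall>V\<in>cyl ` ?\<F>. openin ?P V"
      "\<forall>U. openin ?P U \<and> x \<in> U \<longrightarrow> (\<exists>V\<in>cyl ` ?\<F>. x \<in> V \<and> V \<subseteq> U)"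
    by simp_all
  then show "\<exists>\<B>. countable \<B> \<and> (\<forall>V\<in>\<B>. openin ?P V) \<and>
      (\<forall>U. openin ?P U \<and> x \<in> U \<longrightarrow> (\<exists>V\<in>\<B>. x \<in> V \<and> V \<subseteq> U))"
    by (intro exI conjI)
qed

section \<open>Implications between the properties and descent along retractions\<close>

lemma strictly_angelic_imp_angelic_space: "strictly_angelic_space Y \<Longrightarrow> angelic_space Y"
  by (simp add: strictly_angelic_space_def)

lemma angelic_imp_E_space: "angelic_space Y \<Longrightarrow> E_space Y"
  by (simp add: angelic_space_def E_space_def)

text \<open>The section of a retraction is a closed embedding, so these are instances of the
  heredity to closed subspaces.\<close>

lemma E_space_retraction:
  assumes ret: "retraction_maps Z Y p e" and Y: "Hausdorff_space Y" and Z: "E_space Z"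
  shows "E_space Y"
  unfolding E_space_def
proof (intro conjI allI impI Y)
  fix A assume A: "relatively_countably_compactin Y A"
  have e: "continuous_map Y Z e" and p: "continuous_map Z Y p"
    and pe: "\<And>y. y \<in> topspace Y \<Longrightarrow> p (e y) = y"
    using ret by (auto simp: retraction_maps_def)
  have "relatively_countably_compactin Z (e ` A)"
    using A e Y by (rule relatively_countably_compactin_continuous_map_image)
  then have Z': "compactin Z (Z closure_of (e ` A))" "e ` A \<subseteq> topspace Z"
    using Z by (auto simp: E_space_def relatively_compactin_def)
  have "e ` A \<subseteq> Z closure_of (e ` A)"
    using Z'(2) by (rule closure_of_subset)
  \<comment> \<open>Since \<open>p\<close> undoes \<open>e\<close> on \<open>Y\<close>, the set
    \<open>A\<close> lies in the \<open>p\<close>-image of a compact set, which is compact.\<close>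
  then have "A \<subseteq> p ` (Z closure_of (e ` A))"
    using pe A unfolding relatively_countably_compactin_def by force
  then show "relatively_compactin Y A"
    using relatively_compactin_subset_compactin[OF Y image_compactin[OF Z'(1) p]] by blast
qed

lemma strictly_angelic_space_retraction:
  assumes ret: "retraction_maps Z Y p e" and Y: "Hausdorff_space Y"
    and Z: "strictly_angelic_space Z"
  shows "strictly_angelic_space Y"
  unfolding strictly_angelic_space_def angelic_space_def
proof (intro conjI allI impI ballI Y)
  have e: "continuous_map Y Z e" and p: "continuous_map Z Y p"
    and pe: "\<And>y. y \<in> topspace Y \<Longrightarrow> p (e y) = y"
    using ret by (auto simp: retraction_maps_def)
  fix A assume A: "relatively_countably_compactin Y A"
  have "E_space Y"
    using ret Y Z by (blast intro: E_space_retraction angelic_imp_E_space strictly_angelic_imp_angelic_space)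
  with A show "relatively_compactin Y A"
    by (simp add: E_space_def)
  fix x assume x: "x \<in> Y closure_of A"
  have "relatively_countably_compactin Z (e ` A)"
    using A e Y by (rule relatively_countably_compactin_continuous_map_image)
  moreover have "e x \<in> Z closure_of (e ` A)"
    using x continuous_map_image_closure_subset[OF e] by blast
  ultimately obtain \<sigma> :: "nat \<Rightarrow> _" where \<sigma>: "range \<sigma> \<subseteq> e ` A" "limitin Z \<sigma> (e x) sequentially"
    using Z unfolding strictly_angelic_space_def angelic_space_def by blast
  have "x \<in> topspace Y" using x by (simp add: in_closure_of)
  then have "limitin Y (p \<circ> \<sigma>) x sequentially"
    using continuous_map_limit[OF p \<sigma>(2)] pe by simp
  moreover have "range (p \<circ> \<sigma>) \<subseteq> A"
  proof clarify
    fix n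
    obtain a where "a \<in> A" "\<sigma> n = e a" using \<sigma>(1) by blast
    then show "(p \<circ> \<sigma>) n \<in> A"
      using A pe[of a] by (auto simp: relatively_countably_compactin_def)
  qed
  ultimately show "\<exists>\<sigma>::nat \<Rightarrow> _. range \<sigma> \<subseteq> A \<and> limitin Y \<sigma> x sequentially"
    by blast
next
  have e: "continuous_map Y Z e" and p: "continuous_map Z Y p"
    and pe: "\<And>y. y \<in> topspace Y \<Longrightarrow> p (e y) = y"
    using ret by (auto simp: retraction_maps_def)
  fix K assume K: "compactin Y K \<and> separable_space (subtopology Y K)"
  have KY: "K \<subseteq> topspace Y" using K by (simp add: compactin_subset_topspace)
  have "inj_on e K" using pe KY by (intro inj_on_inverseI[of K p]) auto
  have *: "continuous_map (subtopology Y K) (subtopology Z (e ` K)) e"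
    using e by (auto simp: continuous_map_in_subtopology continuous_map_from_subtopology)
  have cK: "compactin Z (e ` K)"
    using image_compactin e K by blast
  have eZ: "e ` K \<subseteq> topspace Z"
    using cK by (rule compactin_subset_topspace)
  have im: "e ` topspace (subtopology Y K) = topspace (subtopology Z (e ` K))"
    using KY eZ by (simp add: Int_absorb1)
  have "separable_space (subtopology Z (e ` K))"
    using K * im by (blast intro: separable_space_continuous_map_image)
  then have "first_countable (subtopology Z (e ` K))"
    using Z cK unfolding strictly_angelic_space_def by blast
  moreover have "Hausdorff_space Z"
    using Z by (simp add: strictly_angelic_space_def angelic_space_def)
  then have "homeomorphic_map (subtopology Y K) (subtopology Z (e ` K)) e"
    using K \<open>inj_on e K\<close> KY
    by (intro continuous_imp_homeomorphic_map[OF * _ _ im])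
      (simp_all add: compact_space_subtopology Hausdorff_space_subtopology Int_absorb1)
  ultimately show "first_countable (subtopology Y K)"
    by (simp only: homeomorphic_map_imp_homeomorphic_space[THEN homeomorphic_space_first_countability])
qed

lemma Smulian_space_retraction:
  assumes ret: "retraction_maps Z Y p e" and Y: "Hausdorff_space Y" and Z: "Smulian_space Z"
  shows "Smulian_space Y"
  unfolding Smulian_space_def sequentially_compactin_def
proof (intro conjI allI impI Y)
  have e: "continuous_map Y Z e" and p: "continuous_map Z Y p"
    and pe: "\<And>y. y \<in> topspace Y \<Longrightarrow> p (e y) = y"
    using ret by (auto simp: retraction_maps_def)
  fix K assume K: "compactin Y K"
  then show KY: "K \<subseteq> topspace Y" by (rule compactin_subset_topspace)
  fix \<sigma> :: "nat \<Rightarrow> _" assume \<sigma>: "range \<sigma> \<subseteq> K"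
  have "sequentially_compactin Z (e ` K)"
    using Z image_compactin[OF K e] by (simp add: Smulian_space_def)
  moreover have "range (e \<circ> \<sigma>) \<subseteq> e ` K" using \<sigma> by auto
  ultimately obtain l r where lr: "l \<in> e ` K" "strict_mono (r :: nat \<Rightarrow> nat)"
      "limitin Z (e \<circ> \<sigma> \<circ> r) l sequentially"
    unfolding sequentially_compactin_def by meson
  have "p \<circ> (e \<circ> \<sigma> \<circ> r) = \<sigma> \<circ> r"
    using \<sigma> KY pe by (simp add: fun_eq_iff subset_iff)
  then have "limitin Y (\<sigma> \<circ> r) (p l) sequentially"
    using continuous_map_limit[OF p lr(3)] by simp
  moreover have "p l \<in> K" using lr(1) KY pe by auto
  ultimately show "\<exists>l\<in>K. \<exists>r. strict_mono r \<and> limitin Y (\<sigma> \<circ> r) l sequentially"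
    using lr(2) by blast
qed

subsection \<open>Countable tightness\<close>

text \<open>Countable tightness of products of angelic spaces: a set \<open>F\<close> that contains the closures of
  its countable subsets has closed images under maps to an angelic space, so that one can pass
  from \<open>F\<close> to the points of \<open>F\<close> that agree with a given \<open>x \<in> closure F\<close> in one coordinate
  after the other.\<close>

definition countably_closedin :: "'a topology \<Rightarrow> 'a set \<Rightarrow> bool" where
  "countably_closedin Z F \<longleftrightarrow>
     F \<subseteq> topspace Z \<and> (\<forall>B. B \<subseteq> F \<and> countable B \<longrightarrow> Z closure_of B \<subseteq> F)"

lemma countably_closedin_Int_closedin:
  assumes "countably_closedin Z F" "closedin Z U"
  shows "countably_closedin Z (F \<inter> U)"
  using assms unfolding countably_closedin_def
  by (meson closure_of_minimal inf_le1 inf_le2 le_inf_iff order_trans)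

lemma countably_closedin_fibre:
  assumes F: "countably_closedin Z F" and f: "continuous_map Z Y f"
    and Y: "Hausdorff_space Y" and c: "c \<in> topspace Y"
  shows "countably_closedin Z {y \<in> F. f y = c}"
proof -
  have "closedin Z {y \<in> topspace Z. f y \<in> {c}}"
    using f Y c by (intro closedin_continuous_map_preimage)
      (auto simp: closedin_Hausdorff_singleton)
  moreover have "{y \<in> F. f y = c} = F \<inter> {y \<in> topspace Z. f y \<in> {c}}"
    using F by (auto simp: countably_closedin_def)
  ultimately show ?thesis
    using F by (simp add: countably_closedin_Int_closedin)
qed

lemma closedin_image_countably_closedin:
  assumes Z: "compact_space Z" and F: "countably_closedin Z F"
    and Y: "angelic_space Y" and f: "continuous_map Z Y f"
  shows "closedin Y (f ` F)"
proof -
  have hY: "Hausdorff_space Y" using Y by (simp add: angelic_space_def)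
  have FZ: "F \<subseteq> topspace Z" using F by (simp add: countably_closedin_def)
  have fF: "f ` F \<subseteq> topspace Y"
    using FZ continuous_map_image_subset_topspace[OF f] by (meson image_mono order_trans)
  have "compactin Y (f ` topspace Z)"
    using Z f image_compactin compact_space_def by blast
  then have "relatively_compactin Y (f ` F)"
    using relatively_compactin_subset_compactin[OF hY] FZ by (meson image_mono)
  then have rcc: "relatively_countably_compactin Y (f ` F)"
    by (rule relatively_compactin_imp_relatively_countably_compactin)
  have "y \<in> f ` F" if y: "y \<in> Y closure_of (f ` F)" for y
  proof -
    obtain \<sigma> :: "nat \<Rightarrow> _" where \<sigma>: "range \<sigma> \<subseteq> f ` F" "limitin Y \<sigma> y sequentially"
      using Y rcc y unfolding angelic_space_def by meson
    have "\<exists>z. z \<in> F \<and> \<sigma> n = f z" for n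
      using \<sigma>(1) by blast
    then obtain \<tau> where \<tau>: "\<And>n. \<tau> n \<in> F" "\<And>n. \<sigma> n = f (\<tau> n)"
      by metis
    let ?C = "Z closure_of (range \<tau>)"
    have "?C \<subseteq> F"
      using F \<tau>(1) by (simp add: countably_closedin_def image_subset_iff)
    have "range \<tau> \<subseteq> ?C"
      using \<tau>(1) FZ by (intro closure_of_subset) auto
    then have "range \<sigma> \<subseteq> f ` ?C"
      using \<tau>(2) by auto
    have "closedin Y (f ` ?C)"
      using image_compactin[OF closedin_compact_space[OF Z closedin_closure_of] f]
        compactin_imp_closedin[OF hY] by blast
    then have "y \<in> f ` ?C"
      using limitin_closedin[OF \<sigma>(2)] \<open>range \<sigma> \<subseteq> f ` ?C\<close> by (simp add: image_subset_iff)
    with \<open>?C \<subseteq> F\<close> show ?thesis by blast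
  qed
  then show ?thesis
    using fF closure_of_subset_eq by blast
qed

text \<open>By regularity a neighbourhood of \<open>x\<close> contains a closed neighbourhood
  \<open>C\<close>. The set \<open>F \<inter> C\<close> still accumulates at \<open>x\<close> and is
  countably closed, so its image is closed and contains \<open>f x\<close>. Hence the fibre over
  \<open>f x\<close> meets \<open>C\<close>.\<close>

lemma in_closure_of_fibre:
  assumes Z: "compact_space Z" "Hausdorff_space Z" and F: "countably_closedin Z F"
    and Y: "angelic_space Y" and f: "continuous_map Z Y f" and x: "x \<in> Z closure_of F"
  shows "x \<in> Z closure_of {y \<in> F. f y = f x}"
  unfolding in_closure_of
proof (intro conjI allI impI)
  show "x \<in> topspace Z" using x by (simp add: in_closure_of)
  fix T assume T: "x \<in> T \<and> openin Z T"
  have "neighbourhood_base_of (closedin Z) Z"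
    using Z by (simp add: neighbourhood_base_of_closedin compact_Hausdorff_imp_regular_space)
  then obtain U C where UC: "openin Z U" "closedin Z C" "x \<in> U" "U \<subseteq> C" "C \<subseteq> T"
    using T unfolding neighbourhood_base_of by meson
  have "x \<in> Z closure_of (F \<inter> C)"
    unfolding in_closure_of
  proof (intro conjI allI impI)
    fix V assume "x \<in> V \<and> openin Z V"
    then have "x \<in> V \<inter> U \<and> openin Z (V \<inter> U)"
      using UC by (simp add: openin_Int)
    then obtain y where "y \<in> F" "y \<in> V \<inter> U"
      using x unfolding in_closure_of by meson
    then show "\<exists>y. y \<in> F \<inter> C \<and> y \<in> V"
      using UC by blast
  qed fact
  then have "f x \<in> Y closure_of (f ` (F \<inter> C))"
    using continuous_map_image_closure_subset[OF f] by blast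
  moreover have "closedin Y (f ` (F \<inter> C))"
    using Z(1) countably_closedin_Int_closedin[OF F UC(2)] Y f
    by (rule closedin_image_countably_closedin)
  ultimately obtain y where "y \<in> F" "y \<in> C" "f x = f y"
    using closure_of_closedin by blast
  then show "\<exists>y. y \<in> {y \<in> F. f y = f x} \<and> y \<in> T"
    using UC(5) by auto
qed

text \<open>Fixing the coordinates one at a time gives points \<open>y n\<close> of \<open>F\<close>
  that agree with \<open>x\<close> in the first \<open>n\<close> coordinates. A cluster point of
  this sequence has all the coordinates of \<open>x\<close>, so it is \<open>x\<close>, and it lies
  in the closure of a countable subset of \<open>F\<close>.\<close>

lemma closedin_countably_closedin:
  fixes f :: "nat \<Rightarrow> 'a \<Rightarrow> 'b"
  assumes Z: "compact_space Z" "Hausdorff_space Z" and F: "countably_closedin Z F"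
    and Y: "angelic_space Y" and f: "\<And>n. continuous_map Z Y (f n)"
    and inj: "\<And>x y. x \<in> topspace Z \<Longrightarrow> y \<in> topspace Z \<Longrightarrow> (\<And>n. f n x = f n y) \<Longrightarrow> x = y"
  shows "closedin Z F"
proof -
  have hY: "Hausdorff_space Y" using Y by (simp add: angelic_space_def)
  have FZ: "F \<subseteq> topspace Z" using F by (simp add: countably_closedin_def)
  have "x \<in> F" if x: "x \<in> Z closure_of F" for x
  proof -
    have xZ: "x \<in> topspace Z" using x by (simp add: in_closure_of)
    define G where "G n = {y \<in> F. \<forall>i<n. f i y = f i x}" for n
    have G_Suc: "G (Suc n) = {y \<in> G n. f n y = f n x}" for n
      by (auto simp: G_def less_Suc_eq)
    \<comment> \<open>Both claims are carried through the induction: passing to the next fibre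
      preserves closeness to \<open>x\<close> only for countably closed sets.\<close>
    have G: "countably_closedin Z (G n) \<and> x \<in> Z closure_of (G n)" for n
    proof (induction n)
      case 0
      then show ?case using F x by (simp add: G_def)
    next
      case (Suc n)
      have "f n x \<in> topspace Y"
        using xZ continuous_map_image_subset_topspace[OF f] by blast
      with Suc show ?case
        unfolding G_Suc
        using countably_closedin_fibre[OF _ f hY] in_closure_of_fibre[OF Z _ Y f] by simp
    qed
    then have "\<exists>y. y \<in> G n" for n
      using closure_of_empty[of Z] by (metis empty_iff ex_in_conv)
    then obtain y where y: "\<And>n. y n \<in> G n"
      by metis
    then have yF: "range y \<subseteq> F" by (auto simp: G_def)
    define C where "C n = Z closure_of (y ` {n..})" for n
    have yC: "y ` {n..} \<subseteq> C n" for n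
      unfolding C_def using yF FZ by (intro closure_of_subset) auto
    have "\<Inter> (range C) \<noteq> {}"
    proof (rule compact_space_imp_nest[OF Z(1)])
      show "closedin Z (C n)" "C n \<noteq> {}" for n
        using yC[of n] by (auto simp: C_def)
      show "decseq C"
        unfolding C_def by (intro decseq_SucI closure_of_mono image_mono) auto
    qed
    then obtain z where z: "\<And>n. z \<in> C n" by blast
    have "f i z = f i x" for i
    proof -
      \<comment> \<open>The tail begins at \<open>Suc i\<close> because \<open>G n\<close> fixes
        only the coordinates below \<open>n\<close>. On this tail \<open>f i\<close> is constantly
        \<open>f i x\<close>.\<close>
      have "f i z \<in> Y closure_of (f i ` (y ` {Suc i..}))"
        using z[of "Suc i"] continuous_map_image_closure_subset[OF f] unfolding C_def by blast
      moreover have "f i ` (y ` {Suc i..}) \<subseteq> {f i x}"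
        using y by (auto simp: G_def)
      moreover have "closedin Y {f i x}"
        using xZ hY continuous_map_image_subset_topspace[OF f[of i]]
        by (simp add: closedin_Hausdorff_singleton image_subset_iff)
      ultimately show ?thesis
        using closure_of_minimal by blast
    qed
    moreover have "z \<in> topspace Z"
      using z[of 0] by (simp add: C_def in_closure_of)
    ultimately have "z = x"
      using xZ by (intro inj)
    moreover have "C 0 \<subseteq> F"
      using F yF by (simp add: C_def countably_closedin_def)
    ultimately show "x \<in> F"
      using z by blast
  qed
  then show ?thesis
    using FZ closure_of_subset_eq by blast
qed

text \<open>The union \<open>F\<close> of the closures of all countable subsets of \<open>A\<close>
  is countably closed, because a countable union of countable sets is countable. It is therefore
  closed and contains the closure of \<open>A\<close>.\<close>

lemma in_closure_of_countable_subset: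
  fixes f :: "nat \<Rightarrow> 'a \<Rightarrow> 'b"
  assumes Z: "compact_space Z" "Hausdorff_space Z"
    and Y: "angelic_space Y" and f: "\<And>n. continuous_map Z Y (f n)"
    and inj: "\<And>x y. x \<in> topspace Z \<Longrightarrow> y \<in> topspace Z \<Longrightarrow> (\<And>n. f n x = f n y) \<Longrightarrow> x = y"
    and A: "A \<subseteq> topspace Z" and x: "x \<in> Z closure_of A"
  shows "\<exists>B. B \<subseteq> A \<and> countable B \<and> x \<in> Z closure_of B"
proof -
  define F where "F = (\<Union>B\<in>{B. B \<subseteq> A \<and> countable B}. Z closure_of B)"
  have "countably_closedin Z F"
    unfolding countably_closedin_def
  proof (intro conjI allI impI)
    show "F \<subseteq> topspace Z"
      by (auto simp: F_def in_closure_of)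
    fix C assume C: "C \<subseteq> F \<and> countable C"
    then have "\<forall>c\<in>C. \<exists>B. B \<subseteq> A \<and> countable B \<and> c \<in> Z closure_of B"
      by (auto simp: F_def)
    then obtain B where B: "\<And>c. c \<in> C \<Longrightarrow> B c \<subseteq> A \<and> countable (B c) \<and> c \<in> Z closure_of (B c)"
      by metis
    let ?D = "\<Union>c\<in>C. B c"
    have "C \<subseteq> Z closure_of ?D"
    proof
      fix c assume "c \<in> C"
      then show "c \<in> Z closure_of ?D"
        using B[of c] closure_of_mono[of "B c" ?D Z] by blast
    qed
    then have "Z closure_of C \<subseteq> Z closure_of ?D"
      by (simp add: closure_of_minimal)
    moreover have "?D \<subseteq> A" "countable ?D"
      using B C by auto
    ultimately show "Z closure_of C \<subseteq> F"
      unfolding F_def by blast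
  qed
  then have "closedin Z F"
    by (rule closedin_countably_closedin[OF Z _ Y f inj])
  moreover have "A \<subseteq> F"
  proof
    fix a assume "a \<in> A"
    then have "a \<in> Z closure_of {a}" "{a} \<subseteq> A"
      using closure_of_subset[of "{a}" Z] A by auto
    then show "a \<in> F" unfolding F_def by blast
  qed
  ultimately have "x \<in> F"
    using x closure_of_minimal by blast
  then show ?thesis by (auto simp: F_def)
qed

subsection \<open>Spaces of null sequences\<close>

lemma Hausdorff_space_euclidean_t2 [simp]: "Hausdorff_space (euclidean :: 'a::t2_space topology)"
  unfolding Hausdorff_space_def disjnt_def
proof (intro allI impI)
  fix x y :: 'a
  assume "x \<in> topspace euclidean \<and> y \<in> topspace euclidean \<and> x \<noteq> y"
  then obtain U V where "open U" "open V" "x \<in> U" "y \<in> V" "U \<inter> V = {}"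
    using hausdorff by meson
  then show "\<exists>U V. openin euclidean U \<and> openin euclidean V \<and> x \<in> U \<and> y \<in> V \<and> U \<inter> V = {}"
    by (intro exI[of _ U] exI[of _ V]) simp
qed

section \<open>Neighbourhoods of zero and coordinates in \<open>F0\<close>\<close>

lemma open_add_diff_neighbourhood:
  fixes V :: "'a::topological_group_add set"
  assumes V: "open V" "0 \<in> V"
  shows "\<exists>W. open W \<and> 0 \<in> W \<and> (\<forall>a\<in>W. \<forall>b\<in>W. a + b \<in> V \<and> a - b \<in> V)"
proof -
  have "((\<lambda>p. fst p + snd p) \<longlongrightarrow> (0::'a) + 0) (nhds 0 \<times>\<^sub>F nhds 0)"
    "((\<lambda>p. fst p - snd p) \<longlongrightarrow> (0::'a) - 0) (nhds 0 \<times>\<^sub>F nhds 0)"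
    by (intro tendsto_add tendsto_diff filterlim_fst filterlim_snd)+
  then have "\<forall>\<^sub>F p in nhds (0::'a) \<times>\<^sub>F nhds 0. fst p + snd p \<in> V \<and> fst p - snd p \<in> V"
    using V by (intro eventually_conj; simp add: topological_tendstoD)
  \<comment> \<open>Both factors are the same filter, so one predicate \<open>Q\<close> serves for
    both arguments.\<close>
  then obtain Q where Q: "eventually Q (nhds (0::'a))"
    and QV: "\<And>a b. Q a \<Longrightarrow> Q b \<Longrightarrow> a + b \<in> V \<and> a - b \<in> V"
    unfolding eventually_prod_same by auto
  then show ?thesis
    unfolding eventually_nhds by metis
qed

text \<open>These sets are the test neighbourhoods of a cluster point \<open>z\<close> below.
  Openness of \<open>c0_nhd V\<close> at the sequence \<open>x - z\<close> is carried over to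
  \<open>x\<close> by regrouping the sum.\<close>

lemma openin_F0_translate:
  assumes V: "open V" "0 \<in> V"
  shows "openin F0 {x \<in> c0. (\<lambda>n. x n - z n) \<in> c0_nhd V}"
  unfolding openin_F0
proof (intro conjI ballI)
  fix x assume x: "x \<in> {x \<in> c0. (\<lambda>n. x n - z n) \<in> c0_nhd V}"
  have "\<forall>y\<in>c0_nhd V. \<exists>W. open W \<and> 0 \<in> W \<and> (\<lambda>v n. y n + v n) ` c0_nhd W \<subseteq> c0_nhd V"
    using openin_F0_c0_nhd[OF V] unfolding openin_F0 by (rule conjunct2)
  moreover have "(\<lambda>n. x n - z n) \<in> c0_nhd V"
    using x by simp
  ultimately obtain W where W: "open W" "0 \<in> W"
      "(\<lambda>v n. (x n - z n) + v n) ` c0_nhd W \<subseteq> c0_nhd V"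
    by meson
  have "(\<lambda>v n. x n + v n) ` c0_nhd W \<subseteq> {x \<in> c0. (\<lambda>n. x n - z n) \<in> c0_nhd V}"
  proof clarify
    fix v assume v: "v \<in> c0_nhd W"
    then have "(\<lambda>n. (x n - z n) + v n) \<in> c0_nhd V"
      using W(3) by blast
    moreover have "(\<lambda>n. (x n - z n) + v n) = (\<lambda>n. (x n + v n) - z n)"
      by (simp add: algebra_simps)
    moreover have "(\<lambda>n. x n + v n) \<in> c0"
      using x v by (auto simp: c0_def c0_nhd_def intro: tendsto_add_zero)
    ultimately show "(\<lambda>n. x n + v n) \<in> c0 \<and> (\<lambda>n. (x n + v n) - z n) \<in> c0_nhd V"
      by simp
  qed
  with W show "\<exists>W. open W \<and> 0 \<in> W \<and> (\<lambda>v n. x n + v n) ` c0_nhd W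
      \<subseteq> {x \<in> c0. (\<lambda>n. x n - z n) \<in> c0_nhd V}"
    by blast
qed auto

lemma continuous_map_F0_coordinate: "continuous_map F0 euclidean (\<lambda>x. x n)"
  unfolding continuous_map_def
proof (intro conjI allI impI)
  fix U :: "'a set" assume "openin euclidean U"
  then have U: "open U" by simp
  show "openin F0 {x \<in> topspace F0. x n \<in> U}"
    unfolding openin_F0
  proof (intro conjI ballI)
    fix x assume x: "x \<in> {x \<in> topspace F0. x n \<in> U}"
    let ?V = "(\<lambda>b. x n + b) -` U"
    have "open ?V"
      using U by (intro open_vimage continuous_intros)
    moreover have "0 \<in> ?V" using x by simp
    moreover have "(\<lambda>v n. x n + v n) ` c0_nhd ?V \<subseteq> {x \<in> topspace F0. x n \<in> U}"
      using x by (auto simp: c0_nhd_def c0_def intro: tendsto_add_zero)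
    ultimately show "\<exists>V. open V \<and> 0 \<in> V \<and>
        (\<lambda>v n. x n + v n) ` c0_nhd V \<subseteq> {x \<in> topspace F0. x n \<in> U}"
      by blast
  qed simp
qed simp

abbreviation pointwise_topology :: "(nat \<Rightarrow> 'a::topological_space) topology" where
  "pointwise_topology \<equiv> product_topology (\<lambda>_. euclidean) UNIV"

lemma continuous_map_F0_pointwise: "continuous_map F0 pointwise_topology (\<lambda>x. x)"
  by (simp add: continuous_map_componentwise_UNIV continuous_map_F0_coordinate)

lemma Hausdorff_space_pointwise:
  "Hausdorff_space (pointwise_topology :: (nat \<Rightarrow> 'a::t2_space) topology)"
  by (simp add: Hausdorff_space_product_topology)

lemma Hausdorff_space_F0:
  "Hausdorff_space (F0 :: (nat \<Rightarrow> 'a::{topological_ab_group_add,t2_space}) topology)"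
  using Hausdorff_space_pointwise continuous_map_F0_pointwise
  by (rule Hausdorff_space_injective_preimage) simp

section \<open>Uniformly null sets and the pointwise topology\<close>

definition uniformly_null :: "(nat \<Rightarrow> 'a::topological_ab_group_add) set \<Rightarrow> bool" where
  "uniformly_null A \<longleftrightarrow>
     (\<forall>V. open V \<and> 0 \<in> V \<longrightarrow> (\<exists>N. \<forall>x\<in>A. \<forall>n\<ge>N. x n \<in> V))"

lemma uniformly_null_imp_subset_c0: "uniformly_null A \<Longrightarrow> A \<subseteq> c0"
  unfolding uniformly_null_def c0_def tendsto_def eventually_sequentially
  by (intro subsetI CollectI allI impI) meson

text \<open>Choose \<open>W\<close> with all differences of its elements in \<open>V\<close>. Beyond
  some \<open>N\<close> the coordinates of all members of \<open>T\<close> lie in \<open>W\<close>,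
  so any two members differ there by elements of \<open>V\<close>. Uniform closeness within
  \<open>T\<close> thus restricts only finitely many coordinates.\<close>

lemma subtopology_F0_uniformly_null:
  assumes T: "uniformly_null T"
  shows "subtopology F0 T = subtopology pointwise_topology T"
proof -
  have Tc0: "T \<subseteq> c0" using T by (rule uniformly_null_imp_subset_c0)
  have "openin (subtopology F0 T) U \<longleftrightarrow> openin (subtopology pointwise_topology T) U" for U
  proof
    assume "openin (subtopology pointwise_topology T) U"
    then obtain S where S: "openin pointwise_topology S" "U = S \<inter> T"
      by (auto simp: openin_subtopology)
    have "openin F0 {x \<in> topspace F0. x \<in> S}"
      using S(1) by (rule openin_continuous_map_preimage[OF continuous_map_F0_pointwise])
    moreover have "U = {x \<in> topspace F0. x \<in> S} \<inter> T"
      using S(2) Tc0 by auto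
    ultimately show "openin (subtopology F0 T) U"
      by (auto simp: openin_subtopology)
  next
    assume "openin (subtopology F0 T) U"
    then obtain S where S: "openin F0 S" "U = S \<inter> T"
      by (auto simp: openin_subtopology)
    show "openin (subtopology pointwise_topology T) U"
    proof (subst openin_subopen, intro ballI)
      fix x assume x: "x \<in> U"
      then obtain V where V: "open V" "0 \<in> V" "(\<lambda>v n. x n + v n) ` c0_nhd V \<subseteq> S"
        using S unfolding openin_F0 by blast
      obtain W where W: "open W" "0 \<in> W" "\<And>a b. a \<in> W \<Longrightarrow> b \<in> W \<Longrightarrow> a - b \<in> V"
        using open_add_diff_neighbourhood[OF V(1,2)] by blast
      obtain N where N: "\<And>y n. y \<in> T \<Longrightarrow> n \<ge> N \<Longrightarrow> y n \<in> W"
        using T W(1,2) unfolding uniformly_null_def by meson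
      \<comment> \<open>Only the coordinates below \<open>N\<close> are constrained; the remaining
        ones are handled by membership in \<open>T\<close>.\<close>
      let ?O = "{y. \<forall>n\<in>{..<N}. y n \<in> (\<lambda>b. b - x n) -` V}"
      have "open ?O"
        using V(1) by (intro product_topology_basis'[where x = "\<lambda>n. n"])
          (auto intro!: open_vimage continuous_intros)
      then have "openin pointwise_topology ?O"
        by (simp add: euclidean_product_topology)
      then have "openin (subtopology pointwise_topology T) (?O \<inter> T)"
        by (auto simp: openin_subtopology)
      moreover have "x \<in> ?O \<inter> T"
        using x S(2) V(2) by simp
      moreover have "?O \<inter> T \<subseteq> U"
      proof
        fix y assume y: "y \<in> ?O \<inter> T"
        have "y n - x n \<in> V" for n
        proof (cases "n < N")
          case False
          then show ?thesis using W(3) N x y S(2) by simp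
        qed (use y in simp)
        moreover have "(\<lambda>n. y n - x n) \<longlonglongrightarrow> 0 - 0"
          using x y S(2) Tc0 by (intro tendsto_diff) (auto simp: c0_def)
        ultimately have "(\<lambda>n. y n - x n) \<in> c0_nhd V"
          by (simp add: c0_nhd_def c0_def)
        then have "(\<lambda>n. x n + (y n - x n)) \<in> S"
          using V(3) by blast
        then show "y \<in> U" using y S(2) by simp
      qed
      ultimately show "\<exists>O'. openin (subtopology pointwise_topology T) O' \<and> x \<in> O' \<and> O' \<subseteq> U"
        by blast
    qed
  qed
  then show ?thesis by (simp add: topology_eq)
qed

text \<open>If the members \<open>X N\<close> of \<open>A\<close> leave a neighbourhood \<open>V\<close> of zero beyond \<open>N\<close>, then a basic
  neighbourhood of any null sequence contains \<open>X N\<close> for only finitely many \<open>N\<close>.\<close>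

lemma relatively_countably_compactin_F0_imp_uniformly_null:
  fixes A :: "(nat \<Rightarrow> 'a::{topological_ab_group_add,t2_space}) set"
  assumes A: "relatively_countably_compactin F0 A"
  shows "uniformly_null A"
proof (rule ccontr)
  assume "\<not> uniformly_null A"
  then obtain V where V: "open V" "0 \<in> V" "\<And>N. \<exists>x\<in>A. \<exists>n\<ge>N. x n \<notin> V"
    unfolding uniformly_null_def by meson
  then obtain X where X: "\<And>N. X N \<in> A" "\<And>N. \<exists>n\<ge>N. X N n \<notin> V"
    by metis
  have Ac0: "A \<subseteq> c0"
    using A by (simp add: relatively_countably_compactin_def)
  \<comment> \<open>Finitely many null sequences would share an index beyond which all lie in
    \<open>V\<close>, contrary to the choice of \<open>X\<close>. Infinitude is needed to obtain a
    cluster point.\<close>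
  have "infinite (range X)"
  proof
    assume fin: "finite (range X)"
    have "\<forall>\<^sub>F n in sequentially. x n \<in> V" if "x \<in> range X" for x
      using that X(1) Ac0 V(1,2) unfolding c0_def by (blast intro: topological_tendstoD)
    then have "\<forall>\<^sub>F n in sequentially. \<forall>x\<in>range X. x n \<in> V"
      using fin by (intro eventually_ball_finite) simp_all
    then obtain N where "\<And>n. n \<ge> N \<Longrightarrow> \<forall>x\<in>range X. x n \<in> V"
      unfolding eventually_sequentially by meson
    then have "X N n \<in> V" if "n \<ge> N" for n
      using that by simp
    then show False
      using X(2) by meson
  qed
  moreover have "range X \<subseteq> A" "countable (range X)"
    using X(1) by auto
  ultimately have "F0 derived_set_of (range X) \<noteq> {}"
    using A unfolding relatively_countably_compactin_def by meson
  then obtain z where z: "z \<in> F0 derived_set_of (range X)" by blast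
  then have zc0: "z \<in> c0" by (simp add: in_derived_set_of)
  obtain W where W: "open W" "0 \<in> W" "\<And>a b. a \<in> W \<Longrightarrow> b \<in> W \<Longrightarrow> a + b \<in> V"
    using open_add_diff_neighbourhood[OF V(1,2)] by blast
  have "\<forall>\<^sub>F n in sequentially. z n \<in> W"
    using zc0 W(1,2) unfolding c0_def by (blast intro: topological_tendstoD)
  then obtain N where N: "\<And>n. n \<ge> N \<Longrightarrow> z n \<in> W"
    unfolding eventually_sequentially by blast
  let ?U = "{x \<in> c0. (\<lambda>n. x n - z n) \<in> c0_nhd W}"
  have "openin F0 ?U" using W(1,2) by (rule openin_F0_translate)
  moreover have "z \<in> ?U" using zc0 W(2) by (simp add: c0_nhd_def c0_def)
  moreover have "\<forall>U. z \<in> U \<and> openin F0 U \<longrightarrow> infinite (range X \<inter> U)"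
    using z by (simp add: derived_set_of_infinite_openin[OF Hausdorff_space_F0])
  ultimately have "infinite (range X \<inter> ?U)" by meson
  \<comment> \<open>If \<open>X k\<close> is in \<open>?U\<close>, then for \<open>n \<ge> N\<close>
    the value \<open>X k n\<close> is the sum of \<open>X k n - z n\<close> and \<open>z n\<close>,
    both in \<open>W\<close>, so it lies in \<open>V\<close>. But \<open>X k\<close> leaves
    \<open>V\<close> at some index \<open>n \<ge> k\<close>, which forces
    \<open>k < N\<close>.\<close>
  moreover have "range X \<inter> ?U \<subseteq> X ` {..<N}"
  proof clarify
    fix k assume k: "(\<lambda>n. X k n - z n) \<in> c0_nhd W"
    have "X k n \<in> V" if "n \<ge> N" for n
      using W(3)[of "X k n - z n" "z n"] k N[OF that] by (simp add: c0_nhd_def)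
    moreover obtain n where "n \<ge> k" "X k n \<notin> V" using X(2) by blast
    ultimately show "X k \<in> X ` {..<N}"
      by (metis image_eqI le_trans lessThan_iff linorder_not_le)
  qed
  ultimately show False
    using finite_subset by blast
qed

lemma compactin_imp_relatively_countably_compactin:
  assumes "Hausdorff_space Y" "compactin Y K"
  shows "relatively_countably_compactin Y K"
  using relatively_compactin_subset_compactin[OF assms subset_refl]
  by (rule relatively_compactin_imp_relatively_countably_compactin)

lemma subtopology_F0_compactin:
  fixes K :: "(nat \<Rightarrow> 'a::{topological_ab_group_add,t2_space}) set"
  assumes "compactin F0 K"
  shows "subtopology F0 K = subtopology pointwise_topology K"
  using compactin_imp_relatively_countably_compactin[OF Hausdorff_space_F0 assms]
  by (intro subtopology_F0_uniformly_null relatively_countably_compactin_F0_imp_uniformly_null)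

text \<open>The \<open>N\<close> found for \<open>A\<close> and \<open>W\<close> works for the
  closure and \<open>V\<close>: for a single \<open>n \<ge> N\<close>, some \<open>x\<close> in
  \<open>A\<close> has \<open>x n - z n\<close> in \<open>W\<close>, and \<open>z n\<close> is the
  difference of \<open>x n\<close> and this element. In particular pointwise limits of
  \<open>A\<close> remain null sequences.\<close>

lemma uniformly_null_closure_of_pointwise:
  fixes A :: "(nat \<Rightarrow> 'a::topological_ab_group_add) set"
  assumes A: "uniformly_null A"
  shows "uniformly_null (pointwise_topology closure_of A)"
  unfolding uniformly_null_def
proof (intro allI impI; elim conjE)
  fix V :: "'a set" assume V: "open V" "0 \<in> V"
  obtain W where W: "open W" "0 \<in> W" "\<And>a b. a \<in> W \<Longrightarrow> b \<in> W \<Longrightarrow> a - b \<in> V"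
    using open_add_diff_neighbourhood[OF V] by blast
  obtain N where N: "\<And>x n. x \<in> A \<Longrightarrow> n \<ge> N \<Longrightarrow> x n \<in> W"
    using A W(1,2) unfolding uniformly_null_def by meson
  have "z n \<in> V" if z: "z \<in> pointwise_topology closure_of A" and n: "n \<ge> N" for z n
  proof -
    have "open ((\<lambda>b. b - z n) -` W)"
      using W(1) by (intro open_vimage continuous_intros)
    then have "openin pointwise_topology {x \<in> topspace pointwise_topology. x n \<in> (\<lambda>b. b - z n) -` W}"
      by (intro openin_continuous_map_preimage[OF continuous_map_product_projection]) auto
    moreover have "z \<in> {x \<in> topspace pointwise_topology. x n \<in> (\<lambda>b. b - z n) -` W}"
      using W(2) by simp
    ultimately have "\<exists>x. x \<in> A \<and> x \<in> {x \<in> topspace pointwise_topology. x n \<in> (\<lambda>b. b - z n) -` W}"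
      using z unfolding in_closure_of by meson
    then obtain x where "x \<in> A" "x n - z n \<in> W"
      by auto
    then have "x n - (x n - z n) \<in> V"
      using W(3) N n by blast
    then show ?thesis by simp
  qed
  then show "\<exists>N. \<forall>x\<in>pointwise_topology closure_of A. \<forall>n\<ge>N. x n \<in> V" by blast
qed

section \<open>Passage from the group to null sequences\<close>

lemma E_space_F0:
  assumes X: "E_space (euclidean :: 'a::{topological_ab_group_add,t2_space} topology)"
  shows "E_space (F0 :: (nat \<Rightarrow> 'a) topology)"
  unfolding E_space_def
proof (intro conjI allI impI Hausdorff_space_F0)
  fix A :: "(nat \<Rightarrow> 'a) set"
  assume A: "relatively_countably_compactin F0 A"
  let ?K = "\<lambda>n. euclidean closure_of ((\<lambda>x. x n) ` A)"
  let ?T = "pointwise_topology closure_of A"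
  have K: "compactin euclidean (?K n)" for n
  proof -
    have "relatively_countably_compactin euclidean ((\<lambda>x. x n) ` A)"
      using A continuous_map_F0_coordinate Hausdorff_space_F0
      by (rule relatively_countably_compactin_continuous_map_image)
    then show ?thesis
      using X by (simp add: E_space_def relatively_compactin_def)
  qed
  have cP: "compactin pointwise_topology (Pi\<^sub>E UNIV ?K)"
    using K by (simp add: compactin_PiE)
  have "A \<subseteq> Pi\<^sub>E UNIV ?K"
    using closure_of_subset[of _ euclidean] by (fastforce simp: PiE_iff)
  then have cT: "compactin pointwise_topology ?T"
    using relatively_compactin_subset_compactin[OF Hausdorff_space_pointwise cP]
    by (simp add: relatively_compactin_def)
  have uT: "uniformly_null ?T"
    using relatively_countably_compactin_F0_imp_uniformly_null[OF A]
    by (rule uniformly_null_closure_of_pointwise)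
  \<comment> \<open>Compactness depends only on the subspace topology, which on the uniformly null
    set \<open>?T\<close> is the same for \<open>F0\<close> and the pointwise topology.\<close>
  have "compactin F0 ?T"
    using cT uniformly_null_imp_subset_c0[OF uT]
    by (simp add: compactin_subspace subtopology_F0_uniformly_null[OF uT])
  moreover have "A \<subseteq> ?T"
    by (rule closure_of_subset) simp
  ultimately show "relatively_compactin F0 A"
    by (rule relatively_compactin_subset_compactin[OF Hausdorff_space_F0])
qed

text \<open>The coordinate projections of \<open>K\<close> are compact and separable, hence first
  countable. With the pointwise topology, which is its own by compactness, \<open>K\<close> is a
  subspace of their countable product.\<close>

lemma first_countable_F0_compactin:
  fixes K :: "(nat \<Rightarrow> 'a::{topological_ab_group_add,t2_space}) set"
  assumes X: "strictly_angelic_space (euclidean :: 'a topology)"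
    and K: "compactin F0 K" "separable_space (subtopology F0 K)"
  shows "first_countable (subtopology F0 K)"
proof -
  let ?K = "\<lambda>n. (\<lambda>x. x n) ` K"
  have Kc0: "K \<subseteq> topspace F0"
    using K(1) by (rule compactin_subset_topspace)
  have "first_countable (subtopology euclidean (?K n))" for n
  proof -
    have "continuous_map (subtopology F0 K) (subtopology euclidean (?K n)) (\<lambda>x. x n)"
      by (auto simp: continuous_map_in_subtopology
          intro!: continuous_map_from_subtopology continuous_map_F0_coordinate)
    moreover have "(\<lambda>x. x n) ` topspace (subtopology F0 K) = topspace (subtopology euclidean (?K n))"
      using Kc0 by (simp add: Int_absorb1)
    ultimately have "separable_space (subtopology euclidean (?K n))"
      using K(2) by (blast intro: separable_space_continuous_map_image)
    moreover have "compactin euclidean (?K n)"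
      using K(1) continuous_map_F0_coordinate by (rule image_compactin)
    ultimately show ?thesis
      using X unfolding strictly_angelic_space_def by blast
  qed
  then have "first_countable (subtopology pointwise_topology (Pi\<^sub>E UNIV ?K))"
    by (simp add: subtopology_product_topology first_countable_product_topology)
  then have "first_countable (subtopology (subtopology pointwise_topology (Pi\<^sub>E UNIV ?K)) K)"
    by (rule first_countable_subtopology)
  moreover have "Pi\<^sub>E UNIV ?K \<inter> K = K" by auto
  ultimately show ?thesis
    by (simp add: subtopology_F0_compactin[OF K(1)] subtopology_subtopology)
qed

lemma strictly_angelic_space_F0:
  assumes X: "strictly_angelic_space (euclidean :: 'a::{topological_ab_group_add,t2_space} topology)"
  shows "strictly_angelic_space (F0 :: (nat \<Rightarrow> 'a) topology)"
  unfolding strictly_angelic_space_def angelic_space_def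
proof (intro conjI allI impI ballI Hausdorff_space_F0)
  have aX: "angelic_space (euclidean :: 'a topology)"
    using X by (rule strictly_angelic_imp_angelic_space)
  fix A :: "(nat \<Rightarrow> 'a) set"
  assume A: "relatively_countably_compactin F0 A"
  then show rA: "relatively_compactin F0 A"
    using E_space_F0[OF angelic_imp_E_space[OF aX]] by (simp add: E_space_def)
  fix x assume x: "x \<in> F0 closure_of A"
  let ?K = "F0 closure_of A"
  have K: "compactin F0 ?K" and Ac0: "A \<subseteq> topspace F0"
    using rA by (simp_all only: relatively_compactin_def)
  have AK: "A \<subseteq> ?K" using Ac0 by (rule closure_of_subset)
  \<comment> \<open>Countable tightness is applied inside the compact space \<open>?K\<close>, where
    the coordinates are countably many continuous maps to an angelic space that separate
    points.\<close>
  have "\<exists>B. B \<subseteq> A \<and> countable B \<and> x \<in> subtopology F0 ?K closure_of B"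
  proof (rule in_closure_of_countable_subset[where f = "\<lambda>n x. x n"])
    show "compact_space (subtopology F0 ?K)"
      using K by (rule compact_space_subtopology)
    show "Hausdorff_space (subtopology F0 ?K)"
      using Hausdorff_space_F0 by (rule Hausdorff_space_subtopology)
    show "continuous_map (subtopology F0 ?K) euclidean (\<lambda>x. x n)" for n
      by (intro continuous_map_from_subtopology continuous_map_F0_coordinate)
    show "A \<subseteq> topspace (subtopology F0 ?K)"
      using AK Ac0 by simp
    show "x \<in> subtopology F0 ?K closure_of A"
      using x AK by (simp add: closure_of_subtopology Int_absorb1)
  qed (use aX in auto)
  then obtain B where B: "B \<subseteq> A" "countable B" "x \<in> subtopology F0 ?K closure_of B"
    by blast
  let ?L = "F0 closure_of B"
  have xL: "x \<in> ?L"
    using subsetD[OF closure_of_subtopology_subset B(3)] .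
  have LK: "?L \<subseteq> ?K" using B(1) by (rule closure_of_mono)
  have cL: "compactin F0 ?L"
    using closed_compactin[OF K LK closedin_closure_of] .
  have BL: "B \<subseteq> ?L"
    using B(1) Ac0 by (intro closure_of_subset) blast
  have clB: "subtopology F0 ?L closure_of B = ?L"
    using BL by (simp add: closure_of_subtopology Int_absorb1)
  have "topspace (subtopology F0 ?L) = ?L"
    using compactin_subset_topspace[OF cL] by auto
  then have "separable_space (subtopology F0 ?L)"
    unfolding separable_space_def using B(2) BL clB by (intro exI[of _ B]) simp
  then have "first_countable (subtopology F0 ?L)"
    using X cL by (intro first_countable_F0_compactin)
  then obtain \<sigma> :: "nat \<Rightarrow> _" where \<sigma>: "range \<sigma> \<subseteq> B" "limitin (subtopology F0 ?L) \<sigma> x sequentially"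
    using first_countable_closure_of_sequentially[of "subtopology F0 ?L" x B] xL clB by auto
  then have "range \<sigma> \<subseteq> A" "limitin F0 \<sigma> x sequentially"
    using B(1) by (auto simp: limitin_subtopology)
  then show "\<exists>\<sigma>::nat \<Rightarrow> _. range \<sigma> \<subseteq> A \<and> limitin F0 \<sigma> x sequentially"
    by blast
next
  fix K :: "(nat \<Rightarrow> 'a) set"
  assume "compactin F0 K \<and> separable_space (subtopology F0 K)"
  then show "first_countable (subtopology F0 K)"
    using X by (blast intro: first_countable_F0_compactin)
qed

lemma Smulian_space_F0:
  assumes X: "Smulian_space (euclidean :: 'a::{topological_ab_group_add,t2_space} topology)"
  shows "Smulian_space (F0 :: (nat \<Rightarrow> 'a) topology)"
  unfolding Smulian_space_def sequentially_compactin_def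
proof (intro conjI allI impI Hausdorff_space_F0)
  fix K :: "(nat \<Rightarrow> 'a) set"
  assume K: "compactin F0 K"
  then show Kc0: "K \<subseteq> topspace F0" by (rule compactin_subset_topspace)
  fix \<sigma> :: "nat \<Rightarrow> nat \<Rightarrow> 'a"
  assume \<sigma>: "range \<sigma> \<subseteq> K"
  \<comment> \<open>The \<open>n\<close>-th requirement on a subsequence is convergence of the
    \<open>n\<close>-th coordinates. It can be met by refining any given subsequence, as the
    projection of \<open>K\<close> is compact, hence sequentially compact.\<close>
  interpret subseqs "\<lambda>n r. \<exists>l. (\<lambda>k. \<sigma> (r k) n) \<longlonglongrightarrow> l"
  proof
    fix n and s :: "nat \<Rightarrow> nat"
    have "sequentially_compactin euclidean ((\<lambda>x. x n) ` K)"
      using X image_compactin[OF K continuous_map_F0_coordinate] by (simp add: Smulian_space_def)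
    moreover have "range (\<lambda>k. \<sigma> (s k) n) \<subseteq> (\<lambda>x. x n) ` K"
      using \<sigma> by auto
    ultimately obtain l r where "strict_mono (r :: nat \<Rightarrow> nat)"
        "limitin euclidean ((\<lambda>k. \<sigma> (s k) n) \<circ> r) l sequentially"
      unfolding sequentially_compactin_def by meson
    then show "\<exists>r. strict_mono r \<and> (\<exists>l. (\<lambda>k. \<sigma> ((s \<circ> r) k) n) \<longlonglongrightarrow> l)"
      by (auto simp: o_def)
  qed
  have "\<exists>l. (\<lambda>k. \<sigma> (diagseq k) n) \<longlonglongrightarrow> l" for n
  proof -
    \<comment> \<open>The diagonal sequence refines the stage meeting requirement \<open>n\<close>
      only after its first \<open>Suc n\<close> terms; the shift is then removed, as it does not
      affect convergence.\<close>
    have "\<exists>l. (\<lambda>k. \<sigma> ((diagseq \<circ> (+) (Suc n)) k) n) \<longlonglongrightarrow> l"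
    proof (rule diagseq_holds)
      fix r s :: "nat \<Rightarrow> nat" and m
      assume "strict_mono r" "\<exists>l. (\<lambda>k. \<sigma> (s k) m) \<longlonglongrightarrow> l"
      then show "\<exists>l. (\<lambda>k. \<sigma> ((s \<circ> r) k) m) \<longlonglongrightarrow> l"
        using LIMSEQ_subseq_LIMSEQ unfolding o_def by blast
    qed
    then show ?thesis
      using LIMSEQ_offset[of "\<lambda>k. \<sigma> (diagseq k) n" "Suc n"] by (auto simp: add.commute)
  qed
  then have "\<exists>l. \<forall>n. (\<lambda>k. \<sigma> (diagseq k) n) \<longlonglongrightarrow> l n"
    by (intro choice allI)
  then obtain l where l: "\<And>n. (\<lambda>k. \<sigma> (diagseq k) n) \<longlonglongrightarrow> l n"
    by blast
  have lim: "limitin pointwise_topology (\<sigma> \<circ> diagseq) l sequentially"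
    using l by (simp add: limitin_componentwise)
  \<comment> \<open>Compactness survives in the coarser Hausdorff topology, so \<open>K\<close> is
    pointwise closed and contains the coordinatewise limit \<open>l\<close>. Within \<open>K\<close>
    pointwise convergence is convergence in \<open>F0\<close>.\<close>
  have "compactin pointwise_topology K"
    using image_compactin[OF K continuous_map_F0_pointwise] by simp
  then have "closedin pointwise_topology K"
    by (rule compactin_imp_closedin[OF Hausdorff_space_pointwise])
  then have lK: "l \<in> K"
    using limitin_closedin[OF lim] \<sigma> by (simp add: image_subset_iff)
  with lim have "limitin (subtopology pointwise_topology K) (\<sigma> \<circ> diagseq) l sequentially"
    using \<sigma> by (simp add: limitin_subtopology image_subset_iff)
  then have "limitin F0 (\<sigma> \<circ> diagseq) l sequentially"
    by (simp add: subtopology_F0_compactin[OF K, symmetric] limitin_subtopology)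
  then show "\<exists>l\<in>K. \<exists>r. strict_mono r \<and> limitin F0 (\<sigma> \<circ> r) l sequentially"
    using lK subseq_diagseq by blast
qed

section \<open>The group as a retract of its null sequences\<close>

lemma retraction_maps_F0:
  "retraction_maps (F0 :: (nat \<Rightarrow> 'a::topological_ab_group_add) topology) euclidean
     (\<lambda>x. x 0) (\<lambda>a n. if n = 0 then a else 0)"
  unfolding retraction_maps_def
proof (intro conjI ballI continuous_map_F0_coordinate)
  let ?e = "\<lambda>(a::'a) n::nat. if n = 0 then a else 0"
  have c0: "?e a \<in> c0" for a
  proof -
    have "\<forall>\<^sub>F n in sequentially. 0 = ?e a n"
      using eventually_gt_at_top[of 0] by eventually_elim simp
    then show ?thesis
      unfolding c0_def using tendsto_cong[of "\<lambda>_. 0" "?e a" sequentially 0] by simp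
  qed
  show "continuous_map euclidean F0 ?e"
    unfolding continuous_map_def
  proof (intro conjI allI impI)
    show "?e \<in> topspace euclidean \<rightarrow> topspace F0" using c0 by simp
    fix U :: "(nat \<Rightarrow> 'a) set" assume U: "openin F0 U"
    show "openin euclidean {a \<in> topspace euclidean. ?e a \<in> U}"
    proof (subst openin_subopen, intro ballI)
      fix a assume a: "a \<in> {a \<in> topspace euclidean. ?e a \<in> U}"
      have "\<forall>y\<in>U. \<exists>V. open V \<and> 0 \<in> V \<and> (\<lambda>v n. y n + v n) ` c0_nhd V \<subseteq> U"
        using U unfolding openin_F0 by (rule conjunct2)
      moreover have "?e a \<in> U" using a by simp
      ultimately obtain V where V: "open V" "0 \<in> V" "(\<lambda>v n. ?e a n + v n) ` c0_nhd V \<subseteq> U"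
        by meson
      \<comment> \<open>For \<open>b\<close> in this translate of \<open>V\<close>, the sequence
        \<open>?e b\<close> is the sum of \<open>?e a\<close> and \<open>?e (b - a)\<close>. All
        coordinates of the latter lie in \<open>V\<close>: the zeroth is \<open>b - a\<close>, the
        others are \<open>0\<close>.\<close>
      let ?O = "(\<lambda>b. b - a) -` V"
      have "open ?O" using V(1) by (intro open_vimage continuous_intros)
      then have "openin euclidean ?O" by simp
      moreover have "a \<in> ?O" using V(2) by simp
      moreover have "?O \<subseteq> {a \<in> topspace euclidean. ?e a \<in> U}"
      proof
        fix b assume "b \<in> ?O"
        then have "?e (b - a) \<in> c0_nhd V"
          using c0 V(2) by (simp add: c0_nhd_def)
        then have "(\<lambda>n. ?e a n + ?e (b - a) n) \<in> U"
          using V(3) by blast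
        moreover have "(\<lambda>n. ?e a n + ?e (b - a) n) = ?e b" by auto
        ultimately show "b \<in> {a \<in> topspace euclidean. ?e a \<in> U}" by simp
      qed
      ultimately show "\<exists>T. openin euclidean T \<and> a \<in> T \<and> T \<subseteq> {a \<in> topspace euclidean. ?e a \<in> U}"
        by (intro exI conjI)
    qed
  qed
qed simp

theorem theorem1p9:
  shows "(E_space (euclidean :: 'a::{topological_ab_group_add, t2_space} topology)
            \<longleftrightarrow> E_space (F0 :: (nat \<Rightarrow> 'a) topology))
       \<and> (strictly_angelic_space (euclidean :: 'a topology)
            \<longleftrightarrow> strictly_angelic_space (F0 :: (nat \<Rightarrow> 'a) topology))
       \<and> (Smulian_space (euclidean :: 'a topology)
            \<longleftrightarrow> Smulian_space (F0 :: (nat \<Rightarrow> 'a) topology))"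
  using E_space_F0 strictly_angelic_space_F0 Smulian_space_F0
    E_space_retraction[OF retraction_maps_F0 Hausdorff_space_euclidean_t2]
    strictly_angelic_space_retraction[OF retraction_maps_F0 Hausdorff_space_euclidean_t2]
    Smulian_space_retraction[OF retraction_maps_F0 Hausdorff_space_euclidean_t2]
  by blast

end
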